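(* Let $C$ be a coalgebra, $B$ a bialgebra and $H$ a Hopf algebra, all over a field $k$. Then the poset of subcoalgebras of $C$, the poset of subbialgebras of $B$, and the poset of sub-Hopf algebras of $H$, each ordered by inclusion, are complete lattices, which additionally are algebraic and dually algebraic when $C$, $B$, $H$ are finite dimensional.
   Context: A lattice is complete if every subset has a supremum and an infimum. An element $z$ of a lattice $\Lambda$ is compact if whenever $z\le\bigvee S$ for a subset $S\subseteq\Lambda$ there is a finite $S_f\subseteq S$ with $z\le\bigvee S_f$. A lattice is algebraic if it is complete and every element is a supremum of compact elements; it is dually algebraic if the lattice with the dual order is algebraic. *)

theory Defs
  imports Complex_Main "HOL-Library.Poly_Mapping" "HOL-Algebra.Complete_Lattice"
begin

section \<open>Algebraic and dually algebraic lattices\<close>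

definition compact_element :: "('a, 'm) gorder_scheme \<Rightarrow> 'a \<Rightarrow> bool" where
  "compact_element L z \<longleftrightarrow> z \<in> carrier L \<and>
     (\<forall>A \<subseteq> carrier L. z \<sqsubseteq>\<^bsub>L\<^esub> \<Squnion>\<^bsub>L\<^esub>A \<longrightarrow> (\<exists>F \<subseteq> A. finite F \<and> z \<sqsubseteq>\<^bsub>L\<^esub> \<Squnion>\<^bsub>L\<^esub>F))"

definition algebraic_lattice :: "('a, 'm) gorder_scheme \<Rightarrow> bool" where
  "algebraic_lattice L \<longleftrightarrow> complete_lattice L \<and>
     (\<forall>x \<in> carrier L. \<exists>A \<subseteq> {z. compact_element L z}. x = \<Squnion>\<^bsub>L\<^esub>A)"

definition dually_algebraic_lattice :: "('a, 'm) gorder_scheme \<Rightarrow> bool" where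
  "dually_algebraic_lattice L \<longleftrightarrow> algebraic_lattice (inv_gorder L)"

abbreviation inclusion_order :: "('a set \<Rightarrow> bool) \<Rightarrow> 'a set gorder" where
  "inclusion_order P \<equiv> \<lparr>carrier = {D. P D}, eq = (=), le = (\<subseteq>)\<rparr>"


section \<open>Free vector spaces and their quotients\<close>

text \<open>
  The free vector space on \<open>'x\<close> is \<open>'x \<Rightarrow>\<^sub>0 'k\<close>, with basis vectors \<open>free_basis x\<close>.
  All other vector spaces are whole types with an explicit scalar multiplication
  \<open>s :: 'k \<Rightarrow> 'c \<Rightarrow> 'c\<close>, as in \<^locale>\<open>vector_space\<close>.
\<close>

definition free_scale :: "'k::field \<Rightarrow> ('x \<Rightarrow>\<^sub>0 'k) \<Rightarrow> ('x \<Rightarrow>\<^sub>0 'k)" where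
  "free_scale a u = Poly_Mapping.map ((*) a) u"

lemma lookup_free_scale [simp]: "Poly_Mapping.lookup (free_scale a u) x = a * Poly_Mapping.lookup u x"
  by (auto simp: free_scale_def Poly_Mapping.map.rep_eq when_def)

global_interpretation free: vector_space free_scale
  by unfold_locales (auto intro!: poly_mapping_eqI simp: lookup_add algebra_simps)

definition free_basis :: "'x \<Rightarrow> 'x \<Rightarrow>\<^sub>0 'k::field" where
  "free_basis x = Poly_Mapping.single x 1"

text \<open>The linear extension of \<open>f\<close> to the free vector space; \<open>s\<close> is the scalar multiplication of
  the codomain.\<close>

definition free_extend :: "('k::field \<Rightarrow> 'v::ab_group_add \<Rightarrow> 'v) \<Rightarrow> ('x \<Rightarrow> 'v) \<Rightarrow> ('x \<Rightarrow>\<^sub>0 'k) \<Rightarrow> 'v" where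
  "free_extend s f u = (\<Sum>x \<in> Poly_Mapping.keys u. s (Poly_Mapping.lookup u x) (f x))"

text \<open>
  Elements of the quotient of a free vector space by a subspace \<open>N\<close> are the cosets of \<open>N\<close>.
  Maps out of the quotient are computed on the representative chosen by \<open>rep\<close>; every map
  defined below by means of \<open>rep\<close> is independent of that choice whenever the maps entering its
  definition are linear.
\<close>

definition coset :: "('x \<Rightarrow>\<^sub>0 'k::field) set \<Rightarrow> ('x \<Rightarrow>\<^sub>0 'k) \<Rightarrow> ('x \<Rightarrow>\<^sub>0 'k) set" where
  "coset N u = {v. v - u \<in> N}"

definition rep :: "('x \<Rightarrow>\<^sub>0 'k::field) set \<Rightarrow> ('x \<Rightarrow>\<^sub>0 'k)" where
  "rep X = (SOME u. u \<in> X)"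

definition coset_add ::
  "('x \<Rightarrow>\<^sub>0 'k::field) set \<Rightarrow> ('x \<Rightarrow>\<^sub>0 'k) set \<Rightarrow> ('x \<Rightarrow>\<^sub>0 'k) set \<Rightarrow> ('x \<Rightarrow>\<^sub>0 'k) set" where
  "coset_add N X Y = coset N (rep X + rep Y)"

definition coset_scale ::
  "('x \<Rightarrow>\<^sub>0 'k::field) set \<Rightarrow> 'k \<Rightarrow> ('x \<Rightarrow>\<^sub>0 'k) set \<Rightarrow> ('x \<Rightarrow>\<^sub>0 'k) set" where
  "coset_scale N a X = coset N (free_scale a (rep X))"

lemma coset_eq_iff:
  assumes "free.subspace N"
  shows "coset N u = coset N v \<longleftrightarrow> u - v \<in> N"
proof
  assume "coset N u = coset N v"
  moreover have "u \<in> coset N u" using assms by (simp add: coset_def free.subspace_0)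
  ultimately show "u - v \<in> N" by (simp add: coset_def)
next
  assume uv: "u - v \<in> N"
  have "w - u \<in> N \<longleftrightarrow> w - v \<in> N" for w
    using free.subspace_add[OF assms _ uv, of "w - u"] free.subspace_diff[OF assms _ uv, of "w - v"]
    by auto
  then show "coset N u = coset N v" by (simp add: coset_def)
qed

lemma coset_rep:
  assumes "free.subspace N"
  shows "coset N (rep (coset N u)) = coset N u"
proof -
  have "u \<in> coset N u" using assms by (simp add: coset_def free.subspace_0)
  then have "rep (coset N u) \<in> coset N u" unfolding rep_def by (rule someI)
  then show ?thesis by (simp add: coset_eq_iff[OF assms]) (simp add: coset_def)
qed


section \<open>Tensor products\<close>

text \<open>
  \<open>G\<close> is a set of ways of putting a vector into one slot of a tuple, the other entries being
  fixed.  Factoring the free vector space on the tuples by these relations makes it universal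
  for the maps that are linear in each of the slots.
\<close>

definition multilinear_null ::
  "('k::field \<Rightarrow> 'c::ab_group_add \<Rightarrow> 'c) \<Rightarrow> ('c \<Rightarrow> 'x) set \<Rightarrow> ('x \<Rightarrow>\<^sub>0 'k) set" where
  "multilinear_null s G = free.span
     ({free_basis (g (x + y)) - free_basis (g x) - free_basis (g y) | g x y. g \<in> G} \<union>
      {free_basis (g (s a x)) - free_scale a (free_basis (g x)) | g a x. g \<in> G})"

text \<open>\<open>C \<otimes> C\<close> and \<open>C \<otimes> C \<otimes> C\<close> are the free vector spaces on \<open>C \<times> C\<close> and \<open>C \<times> C \<times> C\<close> modulo
  the following subspaces.\<close>

definition null2 :: "('k::field \<Rightarrow> 'c::ab_group_add \<Rightarrow> 'c) \<Rightarrow> ('c \<times> 'c \<Rightarrow>\<^sub>0 'k) set" where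
  "null2 s = multilinear_null s (range (\<lambda>y x. (x, y)) \<union> range (\<lambda>x y. (x, y)))"

definition null3 :: "('k::field \<Rightarrow> 'c::ab_group_add \<Rightarrow> 'c) \<Rightarrow> ('c \<times> 'c \<times> 'c \<Rightarrow>\<^sub>0 'k) set" where
  "null3 s = multilinear_null s
     (range (\<lambda>(y, z) x. (x, y, z)) \<union> range (\<lambda>(x, z) y. (x, y, z)) \<union> range (\<lambda>(x, y) z. (x, y, z)))"

type_synonym ('c, 'k) tensor2 = "('c \<times> 'c \<Rightarrow>\<^sub>0 'k) set"
type_synonym ('c, 'k) tensor3 = "('c \<times> 'c \<times> 'c \<Rightarrow>\<^sub>0 'k) set"

definition tensor_square :: "('k::field \<Rightarrow> 'c::ab_group_add \<Rightarrow> 'c) \<Rightarrow> ('c, 'k) tensor2 set" where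
  "tensor_square s = range (coset (null2 s))"

definition pure_tensor ::
  "('k::field \<Rightarrow> 'c::ab_group_add \<Rightarrow> 'c) \<Rightarrow> 'c \<Rightarrow> 'c \<Rightarrow> ('c, 'k) tensor2" where
  "pure_tensor s x y = coset (null2 s) (free_basis (x, y))"

text \<open>The linear map \<open>C \<otimes> C \<rightarrow> C\<close> induced by a bilinear map \<open>\<beta>\<close>.\<close>

definition tensor_lift ::
  "('k::field \<Rightarrow> 'c::ab_group_add \<Rightarrow> 'c) \<Rightarrow> ('c \<Rightarrow> 'c \<Rightarrow> 'c) \<Rightarrow> ('c, 'k) tensor2 \<Rightarrow> 'c" where
  "tensor_lift s \<beta> X = free_extend s (\<lambda>(x, y). \<beta> x y) (rep X)"

text \<open>The maps \<open>\<Delta> \<otimes> id\<close> and \<open>id \<otimes> \<Delta>\<close> from \<open>C \<otimes> C\<close> to \<open>C \<otimes> C \<otimes> C\<close>.\<close>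

definition comult_left ::
  "('k::field \<Rightarrow> 'c::ab_group_add \<Rightarrow> 'c) \<Rightarrow> ('c \<Rightarrow> ('c, 'k) tensor2) \<Rightarrow> ('c, 'k) tensor2 \<Rightarrow> ('c, 'k) tensor3" where
  "comult_left s \<Delta> X = coset (null3 s)
     (free_extend free_scale
       (\<lambda>(x, y). free_extend free_scale (\<lambda>(x1, x2). free_basis (x1, x2, y)) (rep (\<Delta> x))) (rep X))"

definition comult_right ::
  "('k::field \<Rightarrow> 'c::ab_group_add \<Rightarrow> 'c) \<Rightarrow> ('c \<Rightarrow> ('c, 'k) tensor2) \<Rightarrow> ('c, 'k) tensor2 \<Rightarrow> ('c, 'k) tensor3" where
  "comult_right s \<Delta> X = coset (null3 s)
     (free_extend free_scale
       (\<lambda>(x, y). free_extend free_scale (\<lambda>(y1, y2). free_basis (x, y1, y2)) (rep (\<Delta> y))) (rep X))"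

text \<open>The multiplication \<open>(x \<otimes> y) (x' \<otimes> y') = x x' \<otimes> y y'\<close> of \<open>B \<otimes> B\<close>.\<close>

definition tensor_mult ::
  "('k::field \<Rightarrow> 'b::ring_1 \<Rightarrow> 'b) \<Rightarrow> ('b, 'k) tensor2 \<Rightarrow> ('b, 'k) tensor2 \<Rightarrow> ('b, 'k) tensor2" where
  "tensor_mult s X Y = coset (null2 s)
     (free_extend free_scale
       (\<lambda>(x, y). free_extend free_scale (\<lambda>(x', y'). free_basis (x * x', y * y')) (rep Y)) (rep X))"


section \<open>Coalgebras, bialgebras and Hopf algebras\<close>

text \<open>In the counit axioms \<open>\<epsilon> \<otimes> id\<close> and \<open>id \<otimes> \<epsilon>\<close> are composed with the canonical isomorphisms
  \<open>k \<otimes> C \<cong> C\<close> and \<open>C \<otimes> k \<cong> C\<close>.\<close>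

locale coalgebra = vector_space s
  for s :: "'k::field \<Rightarrow> 'c::ab_group_add \<Rightarrow> 'c"
    and \<Delta> :: "'c \<Rightarrow> ('c, 'k) tensor2"
    and \<epsilon> :: "'c \<Rightarrow> 'k" +
  assumes comult_closed: "\<Delta> x \<in> tensor_square s"
    and comult_add: "\<Delta> (x + y) = coset_add (null2 s) (\<Delta> x) (\<Delta> y)"
    and comult_scale: "\<Delta> (s a x) = coset_scale (null2 s) a (\<Delta> x)"
    and counit_linear: "Vector_Spaces.linear s (*) \<epsilon>"
    and coassoc: "comult_left s \<Delta> (\<Delta> x) = comult_right s \<Delta> (\<Delta> x)"
    and counit_left: "tensor_lift s (\<lambda>y z. s (\<epsilon> y) z) (\<Delta> x) = x"
    and counit_right: "tensor_lift s (\<lambda>y z. s (\<epsilon> z) y) (\<Delta> x) = x"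

text \<open>The class \<open>ring_1\<close> requires \<open>0 \<noteq> 1\<close>, which loses nothing: \<open>\<epsilon> 1 = 1\<close> excludes the zero ring.\<close>

locale bialgebra = coalgebra s \<Delta> \<epsilon>
  for s :: "'k::field \<Rightarrow> 'b::ring_1 \<Rightarrow> 'b"
    and \<Delta> :: "'b \<Rightarrow> ('b, 'k) tensor2"
    and \<epsilon> :: "'b \<Rightarrow> 'k" +
  assumes scale_mult_left: "s a x * y = s a (x * y)"
    and scale_mult_right: "x * s a y = s a (x * y)"
    and comult_mult: "\<Delta> (x * y) = tensor_mult s (\<Delta> x) (\<Delta> y)"
    and comult_one: "\<Delta> 1 = pure_tensor s 1 1"
    and counit_mult: "\<epsilon> (x * y) = \<epsilon> x * \<epsilon> y"
    and counit_one: "\<epsilon> 1 = 1"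

locale hopf_algebra = bialgebra s \<Delta> \<epsilon>
  for s :: "'k::field \<Rightarrow> 'h::ring_1 \<Rightarrow> 'h"
    and \<Delta> :: "'h \<Rightarrow> ('h, 'k) tensor2"
    and \<epsilon> :: "'h \<Rightarrow> 'k"
    and S :: "'h \<Rightarrow> 'h" +
  assumes antipode_linear: "Vector_Spaces.linear s s S"
    and antipode_left: "tensor_lift s (\<lambda>y z. S y * z) (\<Delta> x) = s (\<epsilon> x) 1"
    and antipode_right: "tensor_lift s (\<lambda>y z. y * S z) (\<Delta> x) = s (\<epsilon> x) 1"


section \<open>Subobjects\<close>

text \<open>The image of \<open>D \<otimes> D\<close> in \<open>C \<otimes> C\<close>; over a field the canonical map is injective, so for a
  subspace \<open>D\<close> this is \<open>D \<otimes> D\<close> regarded as a subspace of \<open>C \<otimes> C\<close>.\<close>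

definition subtensor ::
  "('k::field \<Rightarrow> 'c::ab_group_add \<Rightarrow> 'c) \<Rightarrow> 'c set \<Rightarrow> ('c, 'k) tensor2 set" where
  "subtensor s D = coset (null2 s) ` {u. Poly_Mapping.keys u \<subseteq> D \<times> D}"

definition subcoalgebra ::
  "('k::field \<Rightarrow> 'c::ab_group_add \<Rightarrow> 'c) \<Rightarrow> ('c \<Rightarrow> ('c, 'k) tensor2) \<Rightarrow> 'c set \<Rightarrow> bool" where
  "subcoalgebra s \<Delta> D \<longleftrightarrow> module.subspace s D \<and> \<Delta> ` D \<subseteq> subtensor s D"

definition subbialgebra ::
  "('k::field \<Rightarrow> 'b::ring_1 \<Rightarrow> 'b) \<Rightarrow> ('b \<Rightarrow> ('b, 'k) tensor2) \<Rightarrow> 'b set \<Rightarrow> bool" where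
  "subbialgebra s \<Delta> D \<longleftrightarrow> subcoalgebra s \<Delta> D \<and> 1 \<in> D \<and> (\<forall>x \<in> D. \<forall>y \<in> D. x * y \<in> D)"

definition sub_hopf_algebra ::
  "('k::field \<Rightarrow> 'h::ring_1 \<Rightarrow> 'h) \<Rightarrow> ('h \<Rightarrow> ('h, 'k) tensor2) \<Rightarrow> ('h \<Rightarrow> 'h) \<Rightarrow> 'h set \<Rightarrow> bool" where
  "sub_hopf_algebra s \<Delta> S D \<longleftrightarrow> subbialgebra s \<Delta> D \<and> S ` D \<subseteq> D"

definition finite_dimensional :: "('k::field \<Rightarrow> 'v::ab_group_add \<Rightarrow> 'v) \<Rightarrow> bool" where
  "finite_dimensional s \<longleftrightarrow> (\<exists>Basis. finite_dimensional_vector_space s Basis)"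

end

theory Submission
  imports Defs
begin

text \<open>
  The three posets are complete because their members are closed under intersection and the
  whole space is a member: suprema are then intersections of the upper bounds.  Intersections are
  the right operation here, since containing \<open>1\<close> and being stable under the product or the antipode
  pass to intersections trivially, whereas for sums one would have to know that the antipode reverses
  products.

  The one point with content is that \<open>\<Delta> (\<Inter>T) \<subseteq> \<Inter>T \<otimes> \<Inter>T\<close>, that is, that \<open>D \<mapsto> D \<otimes> D\<close> commutes with
  arbitrary nonempty intersections (\<open>Inter_subtensor_subset\<close>).  This follows from a description of
  \<open>D \<otimes> D\<close> in which \<open>D\<close> occurs only as the set to which certain vectors belong
  (\<open>coset_mem_subtensor_iff\<close>): a tensor \<open>t\<close> lies in \<open>D \<otimes> D\<close> iff the contractions \<open>(f \<otimes> id) t\<close> and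
  \<open>(id \<otimes> f) t\<close> lie in \<open>D\<close> for all linear functionals \<open>f\<close>.  For the nontrivial direction take a basis
  of \<open>C\<close> that extends one of \<open>D\<close> and expand \<open>t = \<Sum> t\<^bsub>bc\<^esub> b \<otimes> c\<close>; contracting the first slot with the
  coordinate functional of \<open>b\<close> gives \<open>\<Sum>\<^bsub>c\<^esub> t\<^bsub>bc\<^esub> c\<close>, which lies in \<open>D\<close> only if \<open>t\<^bsub>bc\<^esub> = 0\<close> for every \<open>c\<close>
  outside \<open>D\<close>, and likewise for the second slot.

  In finite dimension, the dimension is strictly monotone and bounded on subspaces.  So a
  finite join of greatest dimension among the finite joins of a family is already the join of the
  whole family, and every element of the lattice is compact (\<open>algebraic_lattice_if_bounded_height\<close>); the codimension does the same for the dual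
  order.
\<close>

section \<open>Lattices of sets\<close>

lemma complete_lattice_inclusion_order:
  assumes UNIV: "P UNIV"
    and Inter: "\<And>T. T \<noteq> {} \<Longrightarrow> (\<And>D. D \<in> T \<Longrightarrow> P D) \<Longrightarrow> P (\<Inter>T)"
  shows "complete_lattice (inclusion_order P)"
proof -
  interpret partial_order "inclusion_order P"
    by unfold_locales auto
  show ?thesis
  proof (rule complete_lattice_criterion1)
    show "\<exists>g. greatest (inclusion_order P) g (carrier (inclusion_order P))"
      using UNIV by (auto simp: greatest_def)
  next
    fix T assume T: "T \<subseteq> carrier (inclusion_order P)" "T \<noteq> {}"
    then have "P (\<Inter>T)"
      using Inter by auto
    then have "greatest (inclusion_order P) (\<Inter>T) (Lower (inclusion_order P) T)"
      using T by (auto simp: greatest_def Lower_def)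
    then show "\<exists>i. greatest (inclusion_order P) i (Lower (inclusion_order P) T)" ..
  qed
qed

text \<open>Among the finite subsets of a family \<open>A\<close> choose \<open>F\<close> with a join of greatest height.  Adding a
  further member of \<open>A\<close> to \<open>F\<close> cannot raise the height, hence does not change the join, so \<open>\<Squnion>F\<close>
  already bounds \<open>A\<close>.  Thus all elements are compact.\<close>

lemma (in complete_lattice) algebraic_lattice_if_bounded_height:
  fixes h :: "'a \<Rightarrow> nat"
  assumes strict: "\<And>x y. x \<in> carrier L \<Longrightarrow> y \<in> carrier L \<Longrightarrow> x \<sqsubseteq> y \<Longrightarrow> x \<noteq> y \<Longrightarrow> h x < h y"
    and bounded: "\<And>x. x \<in> carrier L \<Longrightarrow> h x \<le> N"
  shows "algebraic_lattice L"
proof -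
  have compact: "compact_element L z" if z: "z \<in> carrier L" for z
    unfolding compact_element_def
  proof (intro conjI allI impI z)
    fix A assume A: "A \<subseteq> carrier L" and z_le: "z \<sqsubseteq> \<Squnion>A"
    define Q where "Q F \<longleftrightarrow> F \<subseteq> A \<and> finite F" for F
    have closed: "F \<subseteq> carrier L" if "Q F" for F
      using that A by (auto simp: Q_def)
    have "\<exists>F. Q F \<and> (\<forall>G. Q G \<longrightarrow> h (\<Squnion>G) \<le> h (\<Squnion>F))"
    proof (rule ex_has_greatest_nat)
      show "Q {}" by (simp add: Q_def)
      show "\<forall>F. Q F \<longrightarrow> h (\<Squnion>F) < Suc N"
        using closed bounded by (simp add: less_Suc_eq_le)
    qed
    then obtain F where F: "Q F" and max: "\<And>G. Q G \<Longrightarrow> h (\<Squnion>G) \<le> h (\<Squnion>F)"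
      by blast
    have "a \<sqsubseteq> \<Squnion>F" if a: "a \<in> A" for a
    proof -
      have G: "Q (insert a F)"
        using F a by (simp add: Q_def)
      have le: "\<Squnion>F \<sqsubseteq> \<Squnion>(insert a F)"
        using closed[OF F] closed[OF G] by (intro sup_least sup_upper) auto
      have "\<Squnion>F = \<Squnion>(insert a F)"
        using strict[OF _ _ le] max[OF G] closed[OF F] closed[OF G]
        by (meson not_less sup_closed)
      then show ?thesis
        using sup_upper[OF closed[OF G], of a] by simp
    qed
    then have "\<Squnion>A \<sqsubseteq> \<Squnion>F"
      using A closed[OF F] by (intro sup_least) auto
    then have "z \<sqsubseteq> \<Squnion>F"
      using z z_le A closed[OF F] by (meson le_trans sup_closed)
    then show "\<exists>F \<subseteq> A. finite F \<and> z \<sqsubseteq> \<Squnion>F"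
      using F by (auto simp: Q_def)
  qed
  have "\<exists>A \<subseteq> {z. compact_element L z}. x = \<Squnion>A" if "x \<in> carrier L" for x
    using that compact by (intro exI[of _ "{x}"]) simp
  then show ?thesis
    using complete_lattice_axioms by (simp add: algebraic_lattice_def)
qed

lemma (in complete_lattice) complete_lattice_inv_gorder: "complete_lattice (inv_gorder L)"
proof -
  interpret dual: partial_order "inv_gorder L"
    by (rule dual_order)
  show ?thesis
    by unfold_locales (simp_all add: sup_exists inf_exists)
qed

lemma algebraic_lattice_of_subspaces:
  assumes fin: "finite_dimensional s"
    and lattice: "complete_lattice (inclusion_order P)"
    and subspace: "\<And>D. P D \<Longrightarrow> module.subspace s D"
  shows "algebraic_lattice (inclusion_order P)"
    and "dually_algebraic_lattice (inclusion_order P)"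
proof -
  obtain Basis where "finite_dimensional_vector_space s Basis"
    using fin by (auto simp: finite_dimensional_def)
  then interpret finite_dimensional_vector_space s Basis .
  interpret L: complete_lattice "inclusion_order P" by (rule lattice)
  interpret dual: complete_lattice "inv_gorder (inclusion_order P)"
    by (rule L.complete_lattice_inv_gorder)
  have less: "dim D < dim E" if "P D" "P E" "D \<subseteq> E" "D \<noteq> E" for D E
    using that subspace_dim_equal[of D E] subspace by (meson not_less)
  show "algebraic_lattice (inclusion_order P)"
    using less dim_subset_UNIV
    by (intro L.algebraic_lattice_if_bounded_height[of dim dimension]) auto
  show "dually_algebraic_lattice (inclusion_order P)"
    unfolding dually_algebraic_lattice_def
  proof (rule dual.algebraic_lattice_if_bounded_height)
    show "dimension - dim D < dimension - dim E"
      if "D \<in> carrier (inv_gorder (inclusion_order P))" "E \<in> carrier (inv_gorder (inclusion_order P))"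
        "D \<sqsubseteq>\<^bsub>inv_gorder (inclusion_order P)\<^esub> E" "D \<noteq> E" for D E
      using that less[of E D] dim_subset_UNIV[of D] by auto
    show "dimension - dim D \<le> dimension" for D by simp
  qed
qed

section \<open>Free vector spaces and tensor squares\<close>

lemma keys_free_scale: "Poly_Mapping.keys (free_scale a u) \<subseteq> Poly_Mapping.keys u"
  by (auto simp: in_keys_iff)

lemma span_free_basis: "free.span (free_basis ` X) = {u. Poly_Mapping.keys u \<subseteq> X}"
proof (intro equalityI subsetI)
  fix u :: "'a \<Rightarrow>\<^sub>0 'b" assume u: "u \<in> free.span (free_basis ` X)"
  have "free.subspace {u :: 'a \<Rightarrow>\<^sub>0 'b. Poly_Mapping.keys u \<subseteq> X}"
    using subset_trans[OF keys_free_scale] subset_trans[OF keys_add Un_least]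
    by (intro free.subspaceI) simp_all
  then have "free.span (free_basis ` X) \<subseteq> {u :: 'a \<Rightarrow>\<^sub>0 'b. Poly_Mapping.keys u \<subseteq> X}"
    by (intro free.span_minimal) (auto simp: free_basis_def)
  then show "u \<in> {u. Poly_Mapping.keys u \<subseteq> X}"
    using u by blast
next
  fix u :: "'a \<Rightarrow>\<^sub>0 'b" assume "u \<in> {u. Poly_Mapping.keys u \<subseteq> X}"
  then have "Poly_Mapping.keys u \<subseteq> X" by simp
  then have "(\<Sum>x \<in> Poly_Mapping.keys u. free_scale (Poly_Mapping.lookup u x) (free_basis x))
      \<in> free.span (free_basis ` X)"
    by (intro free.span_sum free.span_scale free.span_base) auto
  moreover have "u = (\<Sum>x \<in> Poly_Mapping.keys u. free_scale (Poly_Mapping.lookup u x) (free_basis x))"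
    by (rule poly_mapping_eqI)
      (simp add: lookup_sum free_basis_def lookup_single when_def if_distrib in_keys_iff cong: if_cong)
  ultimately show "u \<in> free.span (free_basis ` X)" by simp
qed

lemma multilinear_null_add:
  "g \<in> G \<Longrightarrow> free_basis (g (x + y)) - free_basis (g x) - free_basis (g y) \<in> multilinear_null s G"
  unfolding multilinear_null_def
  by (rule free.span_base, rule UnI1, rule CollectI, intro exI conjI, rule refl)

lemma multilinear_null_scale:
  "g \<in> G \<Longrightarrow> free_basis (g (s a x)) - free_scale a (free_basis (g x)) \<in> multilinear_null s G"
  unfolding multilinear_null_def
  by (rule free.span_base, rule UnI2, rule CollectI, intro exI conjI, rule refl)

context vector_space
begin

lemma free_extend_superset:
  assumes "finite A" "Poly_Mapping.keys u \<subseteq> A"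
  shows "free_extend scale f u = (\<Sum>x \<in> A. scale (Poly_Mapping.lookup u x) (f x))"
  unfolding free_extend_def using assms
  by (intro sum.mono_neutral_left) (auto simp: in_keys_iff)

lemma linear_free_extend:
  fixes f :: "'x \<Rightarrow> 'b"
  shows "Vector_Spaces.linear free_scale scale (free_extend scale f)"
proof unfold_locales
  fix u v :: "'x \<Rightarrow>\<^sub>0 'a" and a :: 'a
  let ?A = "Poly_Mapping.keys u \<union> Poly_Mapping.keys v"
  show "free_extend scale f (u + v) = free_extend scale f u + free_extend scale f v"
    using keys_add[of u v]
    by (simp add: free_extend_superset[of ?A] lookup_add scale_left_distrib sum.distrib)
  show "free_extend scale f (free_scale a u) = scale a (free_extend scale f u)"
    using keys_free_scale[of a u]
    by (simp add: free_extend_superset[of "Poly_Mapping.keys u"] scale_sum_right)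
qed

lemma free_extend_basis: "free_extend scale f (free_basis x) = f x"
  by (simp add: free_extend_def free_basis_def)

text \<open>The universal property of \<open>C \<otimes> C\<close>: a bilinear map kills the defining relations, so its linear
  extension descends to the quotient.\<close>

lemma free_extend_null2:
  assumes s': "vector_space s'"
    and left: "\<And>y. Vector_Spaces.linear scale s' (\<lambda>x. \<beta> x y)"
    and right: "\<And>x. Vector_Spaces.linear scale s' (\<beta> x)"
    and u: "u \<in> null2 scale"
  shows "free_extend s' (\<lambda>(x, y). \<beta> x y) u = 0"
proof -
  interpret s': vector_space s' by (rule s')
  interpret E: Vector_Spaces.linear free_scale s' "free_extend s' (\<lambda>(x, y). \<beta> x y)"
    by (rule s'.linear_free_extend)
  have l: "\<beta> (x + x') y = \<beta> x y + \<beta> x' y" "\<beta> (scale a x) y = s' a (\<beta> x y)"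
    and r: "\<beta> x (y + y') = \<beta> x y + \<beta> x y'" "\<beta> x (scale a y) = s' a (\<beta> x y)" for x x' y y' a
    using left[of y] right[of x] by (simp_all add: Vector_Spaces.linear_iff)
  show ?thesis
  proof (rule E.eq_0_on_span[OF _ u[unfolded null2_def multilinear_null_def]],
      (erule UnE; elim CollectE exE conjE))
    fix v :: "'b \<times> 'b \<Rightarrow>\<^sub>0 'a" and g and x y :: 'b
    assume v: "v = free_basis (g (x + y)) - free_basis (g x) - free_basis (g y)"
      and "g \<in> range (\<lambda>y x. (x, y)) \<union> range (\<lambda>x y. (x, y))"
    then show "free_extend s' (\<lambda>(x, y). \<beta> x y) v = 0"
      by (auto simp: v E.diff s'.free_extend_basis l(1) r(1))
  next
    fix v :: "'b \<times> 'b \<Rightarrow>\<^sub>0 'a" and g a x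
    assume v: "v = free_basis (g (scale a x)) - free_scale a (free_basis (g x))"
      and "g \<in> range (\<lambda>y x. (x, y)) \<union> range (\<lambda>x y. (x, y))"
    then show "free_extend s' (\<lambda>(x, y). \<beta> x y) v = 0"
      by (auto simp: v E.diff E.scale s'.free_extend_basis l(2) r(2))
  qed
qed

lemma subspace_null2: "free.subspace (null2 scale)"
  by (simp add: null2_def multilinear_null_def free.subspace_span)

text \<open>The tensors \<open>b \<otimes> c\<close> with \<open>b, c \<in> B\<close> span \<open>C \<otimes> C\<close>, stated in the free vector space so that a
  tensor obtains a representative supported on \<open>B \<times> B\<close>.  Modulo the relations each slot is linear, so
  the basis can be replaced by arbitrary vectors in one slot after the other.\<close>

lemma span_basis_tensors_Un_null2:
  assumes "span B = UNIV"
  shows "free.span (free_basis ` (B \<times> B) \<union> null2 scale) = UNIV"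
proof -
  define W where "W = free.span (free_basis ` (B \<times> B) \<union> null2 scale)"
  have W: "free.subspace W" by (simp add: W_def free.subspace_span)
  have null: "u \<in> W" if "u \<in> null2 scale" for u
    using that by (simp add: W_def free.span_base)
  have gen: "free_basis (g (x + y)) - free_basis (g x) - free_basis (g y) \<in> null2 scale"
    "free_basis (g (scale a x)) - free_scale a (free_basis (g x)) \<in> null2 scale"
    if "g \<in> range (\<lambda>y x. (x, y)) \<union> range (\<lambda>x y. (x, y))" for g x y a
    unfolding null2_def using that
    by (rule multilinear_null_add, rule multilinear_null_scale)
  \<comment> \<open>Here \<open>g\<close> puts a vector into one slot, the entry in the other slot being fixed.\<close>
  have slot: "subspace {x. free_basis (g x) \<in> W}"
    if g: "g \<in> range (\<lambda>y x. (x, y)) \<union> range (\<lambda>x y. (x, y))" for g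
  proof (rule subspaceI)
    show "0 \<in> {x. free_basis (g x) \<in> W}"
      using null[OF gen(2)[OF g, of 0 0]] by simp
    show "x + y \<in> {x. free_basis (g x) \<in> W}"
      if "x \<in> {x. free_basis (g x) \<in> W}" "y \<in> {x. free_basis (g x) \<in> W}" for x y
      using that free.subspace_add[OF W null[OF gen(1)[OF g, of x y]], of "free_basis (g x) + free_basis (g y)"]
        free.subspace_add[OF W, of "free_basis (g x)" "free_basis (g y)"]
      by (simp add: algebra_simps)
    show "scale a x \<in> {x. free_basis (g x) \<in> W}"
      if "x \<in> {x. free_basis (g x) \<in> W}" for a x
      using that free.subspace_add[OF W null[OF gen(2)[OF g, of a x]], of "free_scale a (free_basis (g x))"]
        free.subspace_scale[OF W, of "free_basis (g x)" a]
      by simp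
  qed
  have all: "free_basis (g x) \<in> W"
    if "g \<in> range (\<lambda>y x. (x, y)) \<union> range (\<lambda>x y. (x, y))" "\<And>b. b \<in> B \<Longrightarrow> free_basis (g b) \<in> W"
    for g x
    using span_minimal[OF _ slot[OF that(1)], of B] that(2) assms by auto
  have "free_basis (b, c) \<in> W" if "b \<in> B" "c \<in> B" for b c
    using that by (simp add: W_def free.span_base)
  then have "free_basis (b, y) \<in> W" if "b \<in> B" for b y
    using that all[of "\<lambda>y. (b, y)" y] by simp
  then have "free_basis (x, y) \<in> W" for x y
    using all[of "\<lambda>x. (x, y)" x] by simp
  then have "free.span (range free_basis) \<subseteq> W"
    by (intro free.span_minimal W) auto
  then show ?thesis
    by (auto simp: span_free_basis W_def)
qed

end

section \<open>Membership in \<open>D \<otimes> D\<close> by contraction\<close>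

text \<open>The maps \<open>f \<otimes> id\<close> and \<open>id \<otimes> f\<close> from \<open>C \<otimes> C\<close> to \<open>C\<close>, on representatives in the free vector space.\<close>

definition contract_left ::
  "('k::field \<Rightarrow> 'v::ab_group_add \<Rightarrow> 'v) \<Rightarrow> ('v \<Rightarrow> 'k) \<Rightarrow> ('v \<times> 'v \<Rightarrow>\<^sub>0 'k) \<Rightarrow> 'v" where
  "contract_left s f = free_extend s (\<lambda>(x, y). s (f x) y)"

definition contract_right ::
  "('k::field \<Rightarrow> 'v::ab_group_add \<Rightarrow> 'v) \<Rightarrow> ('v \<Rightarrow> 'k) \<Rightarrow> ('v \<times> 'v \<Rightarrow>\<^sub>0 'k) \<Rightarrow> 'v" where
  "contract_right s f = free_extend s (\<lambda>(x, y). s (f y) x)"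

context vector_space
begin

lemma contract_cong:
  assumes f: "Vector_Spaces.linear scale (*) f" and uv: "u - v \<in> null2 scale"
  shows "contract_left scale f u = contract_left scale f v"
    and "contract_right scale f u = contract_right scale f v"
proof -
  interpret L: Vector_Spaces.linear free_scale scale "contract_left scale f"
    unfolding contract_left_def by (rule linear_free_extend)
  interpret R: Vector_Spaces.linear free_scale scale "contract_right scale f"
    unfolding contract_right_def by (rule linear_free_extend)
  have f': "f (x + y) = f x + f y" "f (scale a x) = a * f x" for x y a
    using f by (simp_all add: Vector_Spaces.linear_iff)
  note lin = Vector_Spaces.linear_iff vector_space_axioms
  have "contract_left scale f (u - v) = 0" unfolding contract_left_def
    by (rule free_extend_null2[OF vector_space_axioms _ _ uv])
      (simp_all add: lin f' scale_left_distrib scale_right_distrib mult.commute)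
  then show "contract_left scale f u = contract_left scale f v" by (simp add: L.diff)
  have "contract_right scale f (u - v) = 0" unfolding contract_right_def
    by (rule free_extend_null2[OF vector_space_axioms _ _ uv])
      (simp_all add: lin f' scale_left_distrib scale_right_distrib mult.commute)
  then show "contract_right scale f u = contract_right scale f v" by (simp add: R.diff)
qed

lemma contract_in_subspace:
  assumes "subspace D" "Poly_Mapping.keys u \<subseteq> D \<times> D"
  shows "contract_left scale f u \<in> D" "contract_right scale f u \<in> D"
  using assms by (auto simp: contract_left_def contract_right_def free_extend_def
      intro!: subspace_sum subspace_scale)

text \<open>Contracting with coordinate functionals reads off the coefficients of a tensor with respect to
  the basis \<open>b \<otimes> c\<close>.\<close>

lemma representation_contract:
  assumes B: "independent B" "span B = UNIV" and v: "Poly_Mapping.keys v \<subseteq> B \<times> B"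
    and bc: "b \<in> B" "c \<in> B"
  shows "representation B (contract_left scale (\<lambda>x. representation B x b) v) c = Poly_Mapping.lookup v (b, c)"
    and "representation B (contract_right scale (\<lambda>x. representation B x c) v) b = Poly_Mapping.lookup v (b, c)"
proof -
  let ?r = "representation B" and ?K = "Poly_Mapping.keys v" and ?l = "Poly_Mapping.lookup v"
  have r: "?r (scale a x) d = a * ?r x d" "?r (\<Sum>i\<in>I. h i) d = (\<Sum>i\<in>I. ?r (h i) d)"
    for a x d and I :: "('b \<times> 'b) set" and h
    using B by (simp_all add: representation_scale representation_sum)
  have delta: "(\<Sum>p \<in> ?K. ?l p * (?r (fst p) b * ?r (snd p) c)) = ?l (b, c)"
  proof -
    have "(\<Sum>p \<in> ?K. ?l p * (?r (fst p) b * ?r (snd p) c)) = (\<Sum>p \<in> ?K. if p = (b, c) then ?l p else 0)"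
    proof (intro sum.cong refl)
      fix p assume "p \<in> ?K"
      then have "fst p \<in> B" "snd p \<in> B" using v by auto
      then show "?l p * (?r (fst p) b * ?r (snd p) c) = (if p = (b, c) then ?l p else 0)"
        using B(1) by (auto simp: representation_basis prod_eq_iff)
    qed
    then show ?thesis by (simp add: in_keys_iff)
  qed
  show "?r (contract_left scale (\<lambda>x. ?r x b) v) c = ?l (b, c)"
    "?r (contract_right scale (\<lambda>x. ?r x c) v) b = ?l (b, c)"
    unfolding delta[symmetric] contract_left_def contract_right_def free_extend_def
    by (simp_all add: r case_prod_unfold mult.commute mult.left_commute)
qed

text \<open>Both slots have to be contracted: the left contractions alone only detect membership in
  \<open>C \<otimes> D\<close>.\<close>

lemma coset_mem_subtensor_iff:
  assumes D: "subspace D"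
  shows "coset (null2 scale) u \<in> subtensor scale D \<longleftrightarrow>
    (\<forall>f. Vector_Spaces.linear scale (*) f \<longrightarrow> contract_left scale f u \<in> D \<and> contract_right scale f u \<in> D)"
proof
  assume "coset (null2 scale) u \<in> subtensor scale D"
  then obtain v where "Poly_Mapping.keys v \<subseteq> D \<times> D" "u - v \<in> null2 scale"
    by (auto simp: subtensor_def coset_eq_iff[OF subspace_null2])
  then show "\<forall>f. Vector_Spaces.linear scale (*) f \<longrightarrow> contract_left scale f u \<in> D \<and> contract_right scale f u \<in> D"
    using contract_cong contract_in_subspace[OF D] by metis
next
  assume contract: "\<forall>f. Vector_Spaces.linear scale (*) f \<longrightarrow> contract_left scale f u \<in> D \<and> contract_right scale f u \<in> D"
  obtain BD where BD: "BD \<subseteq> D" "independent BD" "D \<subseteq> span BD"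
    using maximal_independent_subset by blast
  define B where "B = extend_basis BD"
  have B: "independent B" "span B = UNIV" "BD \<subseteq> B"
    using BD(2) by (simp_all add: B_def independent_extend_basis extend_basis_superset)
  have "u \<in> free.span (free_basis ` (B \<times> B) \<union> null2 scale)"
    by (simp add: span_basis_tensors_Un_null2[OF B(2)])
  then obtain v n where v: "Poly_Mapping.keys v \<subseteq> B \<times> B" and n: "n \<in> null2 scale" and u: "u = v + n"
    unfolding free.span_Un span_free_basis free.span_eq_iff[THEN iffD2, OF subspace_null2] by blast
  have uv: "u - v \<in> null2 scale" using n u by simp
  \<comment> \<open>As \<open>B\<close> extends a basis of \<open>D\<close>, vectors of \<open>D\<close> have no coordinates outside \<open>D\<close>.\<close>
  have coord: "c \<in> D" if "x \<in> D" "representation B x c \<noteq> 0" for x c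
  proof -
    have "representation B x = representation BD x"
      using that(1) BD(3) by (intro representation_extend B) auto
    then show ?thesis
      using that(2) BD(1) representation_ne_zero[of BD x c] by auto
  qed
  have "Poly_Mapping.keys v \<subseteq> D \<times> D"
  proof (clarify)
    fix b c assume bc: "(b, c) \<in> Poly_Mapping.keys v"
    then have mem: "b \<in> B" "c \<in> B" and ne: "Poly_Mapping.lookup v (b, c) \<noteq> 0"
      using v by (auto simp: in_keys_iff)
    have lin: "Vector_Spaces.linear scale (*) (\<lambda>x. representation B x d)" for d
      by (rule linear_representation[OF B(1,2)])
    have "contract_left scale (\<lambda>x. representation B x b) v \<in> D"
      using contract lin by (simp flip: contract_cong(1)[OF lin uv])
    then have "c \<in> D"
      by (rule coord) (simp add: representation_contract(1)[OF B(1,2) v mem] ne)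
    moreover have "contract_right scale (\<lambda>x. representation B x c) v \<in> D"
      using contract lin by (simp flip: contract_cong(2)[OF lin uv])
    then have "b \<in> D"
      by (rule coord) (simp add: representation_contract(2)[OF B(1,2) v mem] ne)
    ultimately show "b \<in> D \<and> c \<in> D" by simp
  qed
  then show "coset (null2 scale) u \<in> subtensor scale D"
    using uv by (auto simp: subtensor_def coset_eq_iff[OF subspace_null2])
qed

text \<open>For empty \<open>T\<close> the intersection on the left would also contain sets that are not cosets.\<close>

lemma Inter_subtensor_subset:
  assumes "T \<noteq> {}" and T: "\<And>D. D \<in> T \<Longrightarrow> subspace D"
  shows "(\<Inter>D \<in> T. subtensor scale D) \<subseteq> subtensor scale (\<Inter>T)"
proof
  fix X assume X: "X \<in> (\<Inter>D \<in> T. subtensor scale D)"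
  then obtain u where u: "X = coset (null2 scale) u"
    using \<open>T \<noteq> {}\<close> by (fastforce simp: subtensor_def)
  have "subspace (\<Inter>T)"
    using T by (simp add: subspace_Inter)
  then show "X \<in> subtensor scale (\<Inter>T)"
    using X T unfolding u by (simp add: coset_mem_subtensor_iff)
qed

lemma subcoalgebra_Inter:
  assumes "T \<noteq> {}" and T: "\<And>D. D \<in> T \<Longrightarrow> subcoalgebra scale \<Delta> D"
  shows "subcoalgebra scale \<Delta> (\<Inter>T)"
proof -
  have sub: "\<And>D. D \<in> T \<Longrightarrow> subspace D"
    using T by (simp add: subcoalgebra_def)
  have "\<Delta> ` \<Inter>T \<subseteq> (\<Inter>D \<in> T. subtensor scale D)"
    using T by (fastforce simp: subcoalgebra_def)
  then show ?thesis
    using Inter_subtensor_subset[OF \<open>T \<noteq> {}\<close> sub] subspace_Inter sub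
    by (auto simp: subcoalgebra_def)
qed

end

section \<open>The lattices of subobjects\<close>

lemma (in coalgebra) subcoalgebra_UNIV: "subcoalgebra s \<Delta> UNIV"
  using comult_closed by (auto simp: subcoalgebra_def subtensor_def tensor_square_def)

lemma (in coalgebra) complete_lattice_subcoalgebras:
  "complete_lattice (inclusion_order (subcoalgebra s \<Delta>))"
  by (rule complete_lattice_inclusion_order[OF subcoalgebra_UNIV subcoalgebra_Inter])

lemma (in bialgebra) complete_lattice_subbialgebras:
  "complete_lattice (inclusion_order (subbialgebra s \<Delta>))"
proof (rule complete_lattice_inclusion_order)
  show "subbialgebra s \<Delta> UNIV"
    using subcoalgebra_UNIV by (simp add: subbialgebra_def)
  show "subbialgebra s \<Delta> (\<Inter>T)" if "T \<noteq> {}" "\<And>D. D \<in> T \<Longrightarrow> subbialgebra s \<Delta> D" for T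
    using that subcoalgebra_Inter[of T] by (simp add: subbialgebra_def)
qed

lemma (in hopf_algebra) complete_lattice_sub_hopf_algebras:
  "complete_lattice (inclusion_order (sub_hopf_algebra s \<Delta> S))"
proof (rule complete_lattice_inclusion_order)
  show "sub_hopf_algebra s \<Delta> S UNIV"
    using subcoalgebra_UNIV by (simp add: sub_hopf_algebra_def subbialgebra_def)
  show "sub_hopf_algebra s \<Delta> S (\<Inter>T)"
    if "T \<noteq> {}" and T: "\<And>D. D \<in> T \<Longrightarrow> sub_hopf_algebra s \<Delta> S D" for T
  proof -
    have "S ` \<Inter>T \<subseteq> \<Inter>T"
      using T unfolding sub_hopf_algebra_def by blast
    then show ?thesis
      using that subcoalgebra_Inter[of T] by (simp add: sub_hopf_algebra_def subbialgebra_def)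
  qed
qed

theorem proposition2p1:
  fixes sC :: "'k::field \<Rightarrow> 'c::ab_group_add \<Rightarrow> 'c"
    and \<Delta>C :: "'c \<Rightarrow> ('c, 'k) tensor2" and \<epsilon>C :: "'c \<Rightarrow> 'k"
    and sB :: "'k \<Rightarrow> 'b::ring_1 \<Rightarrow> 'b"
    and \<Delta>B :: "'b \<Rightarrow> ('b, 'k) tensor2" and \<epsilon>B :: "'b \<Rightarrow> 'k"
    and sH :: "'k \<Rightarrow> 'h::ring_1 \<Rightarrow> 'h"
    and \<Delta>H :: "'h \<Rightarrow> ('h, 'k) tensor2" and \<epsilon>H :: "'h \<Rightarrow> 'k" and S :: "'h \<Rightarrow> 'h"
  assumes C: "coalgebra sC \<Delta>C \<epsilon>C"
    and B: "bialgebra sB \<Delta>B \<epsilon>B"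
    and H: "hopf_algebra sH \<Delta>H \<epsilon>H S"
  shows "(complete_lattice (inclusion_order (subcoalgebra sC \<Delta>C)) \<and>
          complete_lattice (inclusion_order (subbialgebra sB \<Delta>B)) \<and>
          complete_lattice (inclusion_order (sub_hopf_algebra sH \<Delta>H S))) \<and>
    (finite_dimensional sC \<longrightarrow>
       algebraic_lattice (inclusion_order (subcoalgebra sC \<Delta>C)) \<and>
       dually_algebraic_lattice (inclusion_order (subcoalgebra sC \<Delta>C))) \<and>
    (finite_dimensional sB \<longrightarrow>
       algebraic_lattice (inclusion_order (subbialgebra sB \<Delta>B)) \<and>
       dually_algebraic_lattice (inclusion_order (subbialgebra sB \<Delta>B))) \<and>
    (finite_dimensional sH \<longrightarrow>
       algebraic_lattice (inclusion_order (sub_hopf_algebra sH \<Delta>H S)) \<and>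
       dually_algebraic_lattice (inclusion_order (sub_hopf_algebra sH \<Delta>H S)))"
proof -
  interpret C: coalgebra sC \<Delta>C \<epsilon>C by (rule C)
  interpret B: bialgebra sB \<Delta>B \<epsilon>B by (rule B)
  interpret H: hopf_algebra sH \<Delta>H \<epsilon>H S by (rule H)
  note lattices = C.complete_lattice_subcoalgebras B.complete_lattice_subbialgebras
    H.complete_lattice_sub_hopf_algebras
  have "C.subspace D" if "subcoalgebra sC \<Delta>C D" for D
    using that by (simp add: subcoalgebra_def)
  note algebraic_C = algebraic_lattice_of_subspaces[OF _ lattices(1) this]
  have "B.subspace D" if "subbialgebra sB \<Delta>B D" for D
    using that by (simp add: subbialgebra_def subcoalgebra_def)
  note algebraic_B = algebraic_lattice_of_subspaces[OF _ lattices(2) this]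
  have "H.subspace D" if "sub_hopf_algebra sH \<Delta>H S D" for D
    using that by (simp add: sub_hopf_algebra_def subbialgebra_def subcoalgebra_def)
  note algebraic_H = algebraic_lattice_of_subspaces[OF _ lattices(3) this]
  show ?thesis
    using lattices algebraic_C algebraic_B algebraic_H by simp
qed

end
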